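(* Let $G$ be a finite permutation group acting transitively on a finite set $\Omega$, $n=|\Omega|$, and let $\mathds{1}$ denote the all-ones vector. Let $u,v,w,x,y_1,\dots,y_m\in\mathbb{R}\Omega$ where $u,v,y_1,\dots,y_m$ are $\{0,1\}$-vectors and $w,x$ have non-negative integer entries, and assume each of these vectors has at least two distinct entries and at most $n-2$ zero entries. Then: (a) (non-$\mathbb{Q}$I) If $w$ and $x$ are design-orthogonal in $\mathcal{K}(G)$, then $w,x$ are witnesses, i.e. $w\cdot x^g$ is independent of $g\in G$. If $w,x$ are witnesses and $\mathcal{K}(G)$ is stratifiable (respectively, commutative), then $w$ and $x$ are design-orthogonal in $\mathcal{K}(G)^{\mathrm{Sym}}$ (respectively, in $\mathcal{K}(G)$). (b) (nonspreading) Suppose $(w\cdot\mathds{1})$ divides $n$. If $u$ and $w$ are design-orthogonal in $\mathcal{K}(G)$, then $u,w$ are witnesses, i.e. $u\cdot w^g$ is independent of $g\in G$. If $u,w$ are witnesses and $\mathcal{K}(G)$ is stratifiable (respectively, commutative), then $u$ and $w$ are design-orthogonal in $\mathcal{K}(G)^{\mathrm{Sym}}$ (respectively, in $\mathcal{K}(G)$). (c) (nonseparating) Suppose $(u\cdot\mathds{1})(v\cdot\mathds{1})=n$. If $u$ and $v$ are design-orthogonal in $\mathcal{K}(G)$, then $u,v$ are witnesses, i.e. $u\cdot v^g$ is independent of $g\in G$. If $u,v$ are witnesses and $\mathcal{K}(G)$ is stratifiable (respectively, commutative), then $u$ and $v$ are design-orthogonal in $\mathcal{K}(G)^{\mathrm{Sym}}$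 (respectively, in $\mathcal{K}(G)$). (d) (nonsynchronising) Suppose $(y_i\cdot\mathds{1})(v\cdot\mathds{1})=n$ for $1\le i\le m$ and $\sum_{i=1}^m y_i=\mathds{1}$. If $y_i$ and $v$ are design-orthogonal in $\mathcal{K}(G)$ for each $1\le i\le m$, then $y_1,\dots,y_m,v$ are witnesses, i.e. for each $i$, $y_i\cdot v^g$ is independent of $g\in G$. If $y_1,\dots,y_m,v$ are witnesses and $\mathcal{K}(G)$ is stratifiable (respectively, commutative), then for every $i$, $y_i$ and $v$ are design-orthogonal in $\mathcal{K}(G)^{\mathrm{Sym}}$ (respectively, in $\mathcal{K}(G)$).
   Context: Vectors are row vectors indexed by a fixed ordering of $\Omega$; $a\cdot b$ is the standard dot product and $u^*$ the conjugate transpose; $v^g$ is $v$ with coordinates permuted by $g$. $\mathcal{K}(G)=\{R_0,\dots,R_d\}$ is the homogeneous coherent configuration of orbitals of $G$ (orbits of $G$ on $\Omega\times\Omega$, $R_0$ the diagonal), with $0/1$ adjacency matrices $A_i$; its adjacency algebra $\mathcal{A}=\mathrm{span}_{\mathbb{C}}\{A_i\}$ is semisimple, $\mathcal{A}=\bigoplus_{t=0}^{m'}\mathcal{A}_t$ with $\mathcal{A}_t$ simple; the central primitive idempotents $\Pi_t$ of $\mathcal{A}$ are the identity elements of the $\mathcal{A}_t$, with $\Pi_0=\frac1nJ$ ($J$ the all-ones matrix). Vectors $a,b\in\mathbb{C}\Omega$ are design-orthogonal in $\mathcal{K}(G)$ if $(a\Pi_ta^* )(b\Pi_tb^* )=0$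 for all $t>0$. The symmetrisation $\mathcal{K}(G)^{\mathrm{Sym}}$ is the partition of $\Omega\times\Omega$ obtained by keeping each symmetric orbital and replacing each pair of mutually converse nonsymmetric orbitals by their union; $\mathcal{K}(G)$ is stratifiable if $\mathcal{K}(G)^{\mathrm{Sym}}$ is again a coherent configuration (then a symmetric association scheme). $\mathcal{K}(G)$ is commutative if its adjacency algebra is commutative. For a commutative association scheme with primitive idempotents $F_0=\frac1nJ,F_1,\dots,F_s$ of its Bose–Mesner algebra, $a,b$ are design-orthogonal in it if $(aF_ja^* )(bF_jb^* )=0$ for all $j\ge1$. *)

theory Defs
  imports "HOL-Analysis.Analysis" "HOL-Algebra.Group_Action"
begin

text \<open>
  The point set \<open>\<Omega>\<close> is the universe of a finite type \<open>'a\<close>, so that \<open>n = CARD('a)\<close>.  Vectors and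
  matrices indexed by \<open>\<Omega>\<close> have the types \<open>complex ^ 'a\<close> and \<open>complex ^ 'a ^ 'a\<close>; vectors act on
  matrices from the left (\<open>v*\<close>), i.e.\ they are row vectors.
\<close>

definition perm_group :: "('a \<Rightarrow> 'a) set \<Rightarrow> ('a \<Rightarrow> 'a) monoid" where
  "perm_group G = (BijGroup UNIV)\<lparr>carrier := G\<rparr>"

definition transitive_permutation_group :: "('a :: finite \<Rightarrow> 'a) set \<Rightarrow> bool" where
  "transitive_permutation_group G \<longleftrightarrow>
     subgroup G (BijGroup UNIV) \<and> transitive_action (perm_group G) UNIV (\<lambda>g. g)"

text \<open>\<open>permute_vec g v\<close> is \<open>v\<^sup>g\<close>: the entry of \<open>v\<close> at \<open>\<alpha>\<close> becomes the entry of \<open>v\<^sup>g\<close> at \<open>g \<alpha>\<close>.\<close>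

definition permute_vec :: "('a \<Rightarrow> 'a) \<Rightarrow> 'b ^ 'a \<Rightarrow> 'b ^ ('a :: finite)" where
  "permute_vec g v = (\<chi> i. v $ inv_into UNIV g i)"

definition witnesses :: "('a \<Rightarrow> 'a) set \<Rightarrow> real ^ 'a \<Rightarrow> real ^ ('a :: finite) \<Rightarrow> bool" where
  "witnesses G a b \<longleftrightarrow> (\<lambda>g. a \<bullet> permute_vec g b) constant_on G"

definition coherent_configuration :: "('a :: finite \<times> 'a) set set \<Rightarrow> bool" where
  "coherent_configuration C \<longleftrightarrow>
     partition_on UNIV C \<and>
     (\<exists>D\<subseteq>C. \<Union>D = Id) \<and>
     (\<forall>R\<in>C. converse R \<in> C) \<and>
     (\<forall>R\<in>C. \<forall>S\<in>C. \<forall>T\<in>C. \<exists>p. \<forall>(i, j)\<in>T. card {k. (i, k) \<in> R \<and> (k, j) \<in> S} = p)"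

definition orbitals :: "('a \<Rightarrow> 'a) set \<Rightarrow> ('a \<times> 'a) set set" where
  "orbitals G = orbits (perm_group G) UNIV (\<lambda>g. map_prod g g)"

text \<open>A symmetric relation \<open>R\<close> is kept, since then \<open>R \<union> converse R = R\<close>.\<close>

definition symmetrisation :: "('a \<times> 'a) set set \<Rightarrow> ('a \<times> 'a) set set" where
  "symmetrisation C = (\<lambda>R. R \<union> converse R) ` C"

definition stratifiable :: "('a :: finite \<times> 'a) set set \<Rightarrow> bool" where
  "stratifiable C \<longleftrightarrow> coherent_configuration (symmetrisation C)"

definition mscale :: "complex \<Rightarrow> complex ^ 'a ^ 'a \<Rightarrow> complex ^ 'a ^ ('a :: finite)" where
  "mscale c M = map_matrix (\<lambda>z. c * z) M"

interpretation mtx: vector_space mscale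
  by unfold_locales (simp_all add: mscale_def vec_eq_iff algebra_simps)

definition adjacency_matrix :: "('a \<times> 'a) set \<Rightarrow> complex ^ 'a ^ ('a :: finite)" where
  "adjacency_matrix R = (\<chi> i j. if (i, j) \<in> R then 1 else 0)"

definition adjacency_algebra :: "('a \<times> 'a) set set \<Rightarrow> (complex ^ 'a ^ ('a :: finite)) set" where
  "adjacency_algebra C = mtx.span (adjacency_matrix ` C)"

definition commutative_cc :: "('a :: finite \<times> 'a) set set \<Rightarrow> bool" where
  "commutative_cc C \<longleftrightarrow>
     (\<forall>X\<in>adjacency_algebra C. \<forall>Y\<in>adjacency_algebra C. X ** Y = Y ** X)"

definition two_sided_ideal ::
    "(complex ^ 'a ^ 'a) set \<Rightarrow> (complex ^ 'a ^ ('a :: finite)) set \<Rightarrow> bool" where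
  "two_sided_ideal A B \<longleftrightarrow>
     B \<subseteq> A \<and> mtx.subspace B \<and> (\<forall>X\<in>A. \<forall>Y\<in>B. X ** Y \<in> B \<and> Y ** X \<in> B)"

text \<open>The algebras \<open>A\<close> below need not contain the identity matrix: a simple component of an
  adjacency algebra has its own identity element.\<close>

definition simple_algebra :: "(complex ^ 'a ^ ('a :: finite)) set \<Rightarrow> bool" where
  "simple_algebra A \<longleftrightarrow>
     (\<exists>X\<in>A. \<exists>Y\<in>A. X ** Y \<noteq> 0) \<and> (\<forall>I. two_sided_ideal A I \<longrightarrow> I = {0} \<or> I = A)"

text \<open>\<open>A\<close> is the internal direct sum of the members of \<open>\<B>\<close>; for a semisimple \<open>A\<close> exactly one such
  \<open>\<B>\<close> exists, so its identity elements do not depend on a choice.\<close>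

definition simple_decomposition ::
    "(complex ^ 'a ^ 'a) set \<Rightarrow> (complex ^ 'a ^ ('a :: finite)) set set \<Rightarrow> bool" where
  "simple_decomposition A \<B> \<longleftrightarrow>
     finite \<B> \<and> (\<forall>B\<in>\<B>. two_sided_ideal A B \<and> simple_algebra B) \<and>
     (\<forall>X\<in>A. \<exists>!f. f \<in> (\<Pi>\<^sub>E B\<in>\<B>. B) \<and> X = (\<Sum>B\<in>\<B>. f B))"

definition identity_element ::
    "(complex ^ 'a ^ 'a) set \<Rightarrow> complex ^ 'a ^ ('a :: finite) \<Rightarrow> bool" where
  "identity_element B P \<longleftrightarrow> P \<in> B \<and> (\<forall>X\<in>B. P ** X = X \<and> X ** P = X)"

definition central_primitive_idempotents ::
    "(complex ^ 'a ^ 'a) set \<Rightarrow> (complex ^ 'a ^ ('a :: finite)) set" where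
  "central_primitive_idempotents A =
     {P. \<exists>\<B>. simple_decomposition A \<B> \<and> (\<exists>B\<in>\<B>. identity_element B P)}"

definition primitive_idempotents ::
    "(complex ^ 'a ^ 'a) set \<Rightarrow> (complex ^ 'a ^ ('a :: finite)) set" where
  "primitive_idempotents A =
     {E \<in> A. E \<noteq> 0 \<and> E ** E = E \<and>
        \<not> (\<exists>P\<in>A. \<exists>Q\<in>A. P \<noteq> 0 \<and> Q \<noteq> 0 \<and> P ** P = P \<and> Q ** Q = Q \<and>
              P ** Q = 0 \<and> Q ** P = 0 \<and> E = P + Q)}"

text \<open>\<open>herm_form a M\<close> is \<open>a M a\<^sup>*\<close>.\<close>

definition herm_form :: "complex ^ 'a \<Rightarrow> complex ^ 'a ^ ('a :: finite) \<Rightarrow> complex" where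
  "herm_form a M = (\<Sum>i\<in>UNIV. (a v* M) $ i * cnj (a $ i))"

definition trivial_idempotent :: "complex ^ 'a ^ ('a :: finite)" where
  "trivial_idempotent = (\<chi> i j. 1 / of_nat CARD('a))"

definition design_orthogonal ::
    "('a \<times> 'a) set set \<Rightarrow> complex ^ 'a \<Rightarrow> complex ^ ('a :: finite) \<Rightarrow> bool" where
  "design_orthogonal C a b \<longleftrightarrow>
     (\<forall>P \<in> central_primitive_idempotents (adjacency_algebra C) - {trivial_idempotent}.
        herm_form a P * herm_form b P = 0)"

text \<open>The corresponding notion in a commutative association scheme \<open>C\<close>, whose Bose--Mesner algebra
  is \<open>adjacency_algebra C\<close>.\<close>

definition scheme_design_orthogonal ::
    "('a \<times> 'a) set set \<Rightarrow> complex ^ 'a \<Rightarrow> complex ^ ('a :: finite) \<Rightarrow> bool" where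
  "scheme_design_orthogonal C a b \<longleftrightarrow>
     (\<forall>F \<in> primitive_idempotents (adjacency_algebra C) - {trivial_idempotent}.
        herm_form a F * herm_form b F = 0)"

definition cvec :: "real ^ 'a \<Rightarrow> complex ^ ('a :: finite)" where
  "cvec v = (\<chi> i. complex_of_real (v $ i))"

definition zero_one_vec :: "real ^ ('a :: finite) \<Rightarrow> bool" where
  "zero_one_vec v \<longleftrightarrow> (\<forall>i. v $ i \<in> {0, 1})"

definition nonneg_int_vec :: "real ^ ('a :: finite) \<Rightarrow> bool" where
  "nonneg_int_vec v \<longleftrightarrow> (\<forall>i. v $ i \<in> \<nat>)"

definition nontrivial_vec :: "real ^ ('a :: finite) \<Rightarrow> bool" where
  "nontrivial_vec v \<longleftrightarrow>
     (\<exists>i j. v $ i \<noteq> v $ j) \<and> card {i. v $ i = 0} + 2 \<le> CARD('a)"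

end

theory Submission
  imports Defs
begin

text \<open>
  The adjacency algebra of the orbitals is a *-closed matrix algebra, so the orthogonal complement of
  an ideal for the trace form is again an ideal; hence every ideal has a Hermitian central unit and
  the units \<open>e\<^sub>B\<close> of the minimal ideals sum to the identity.  If \<open>a\<close> and \<open>b\<close> are design-orthogonal, all
  terms of \<open>a \<bullet> b\<^sup>g = (\<Sum>B. a e\<^sub>B (b\<^sup>g e\<^sub>B)\<^sup>*)\<close> except the one for the trivial idempotent vanish, since
  \<open>a e\<^sub>B a\<^sup>* = \<parallel>a e\<^sub>B\<parallel>\<^sup>2\<close>.

  Conversely, let \<open>M\<^sub>a\<close> be the sum over \<open>g\<close> of the matrices \<open>(a\<^sup>g)\<^sup>* a\<^sup>g\<close>.  It lies in the adjacency algebra and,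
  being symmetric, also in that of the symmetrisation.  If \<open>a\<close> and \<open>b\<close> are witnesses, then
  \<open>M\<^sub>a M\<^sub>b\<close> is a multiple of the all-ones matrix, so a nontrivial primitive idempotent \<open>F\<close> of a
  commutative algebra annihilates \<open>M\<^sub>a\<close> or \<open>M\<^sub>b\<close>; and the trace of \<open>M\<^sub>a F\<close> is \<open>|G| a F a\<^sup>*\<close>.
\<close>

section \<open>Conjugate transposes and the trace form\<close>

definition ctranspose :: "complex ^ 'n ^ 'm \<Rightarrow> complex ^ 'm ^ 'n" where
  "ctranspose M = (\<chi> i j. cnj (M $ j $ i))"

lemma ctranspose_ctranspose [simp]: "ctranspose (ctranspose M) = M"
  by (simp add: ctranspose_def vec_eq_iff)

lemma ctranspose_mult: "ctranspose (X ** Y) = ctranspose Y ** ctranspose X"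
  by (simp add: ctranspose_def matrix_matrix_mult_def vec_eq_iff mult.commute)

text \<open>\<open>\<bullet>\<close> is real-valued, so complex matrices form a real Euclidean space
  in which it is the real part of the Hermitian trace form. Real orthogonality suffices below, since
  it is only used to show that norms vanish and that units are independent.\<close>

lemma inner_matrix_conv_sum: "X \<bullet> Y = Re (\<Sum>i\<in>UNIV. \<Sum>j\<in>UNIV. X $ i $ j * cnj (Y $ i $ j))"
  for X Y :: "complex ^ 'a ^ 'b :: finite"
  by (simp add: inner_vec_def inner_complex_def)

text \<open>Left multiplication by \<open>Z\<close> has left multiplication by
  \<open>ctranspose Z\<close> as its adjoint. This is what makes orthogonality compatible with
  ideals of a star-closed algebra.\<close>

lemma inner_matrix_mult_left: "(Z ** X) \<bullet> Y = X \<bullet> (ctranspose Z ** Y)"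
  for X Y Z :: "complex ^ 'a ^ 'a :: finite"
proof -
  let ?t = "\<lambda>i j k. Z $ i $ k * X $ k $ j * cnj (Y $ i $ j)"
  have "(\<Sum>i\<in>UNIV. \<Sum>j\<in>UNIV. (Z ** X) $ i $ j * cnj (Y $ i $ j)) =
      (\<Sum>i\<in>UNIV. \<Sum>j\<in>UNIV. \<Sum>k\<in>UNIV. ?t i j k)"
    by (simp add: matrix_matrix_mult_def sum_distrib_right)
  also have "\<dots> = (\<Sum>i\<in>UNIV. \<Sum>k\<in>UNIV. \<Sum>j\<in>UNIV. ?t i j k)"
    by (rule sum.cong[OF refl], rule sum.swap)
  also have "\<dots> = (\<Sum>k\<in>UNIV. \<Sum>i\<in>UNIV. \<Sum>j\<in>UNIV. ?t i j k)"
    by (rule sum.swap)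
  also have "\<dots> = (\<Sum>k\<in>UNIV. \<Sum>j\<in>UNIV. \<Sum>i\<in>UNIV. ?t i j k)"
    by (rule sum.cong[OF refl], rule sum.swap)
  also have "\<dots> = (\<Sum>k\<in>UNIV. \<Sum>j\<in>UNIV. X $ k $ j * cnj ((ctranspose Z ** Y) $ k $ j))"
    by (simp add: matrix_matrix_mult_def ctranspose_def sum_distrib_left mult_ac)
  finally show ?thesis by (simp only: inner_matrix_conv_sum)
qed

lemma inner_ctranspose: "ctranspose X \<bullet> ctranspose Y = X \<bullet> Y"
  for X Y :: "complex ^ 'a ^ 'a :: finite"
  unfolding inner_vec_def ctranspose_def
  by (subst sum.swap) (simp add: inner_complex_def)

lemma inner_matrix_mult_right: "(X ** Z) \<bullet> Y = X \<bullet> (Y ** ctranspose Z)"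
  for X Y Z :: "complex ^ 'a ^ 'a :: finite"
proof -
  have "(X ** Z) \<bullet> Y = (ctranspose Z ** ctranspose X) \<bullet> ctranspose Y"
    by (metis ctranspose_mult inner_ctranspose)
  also have "\<dots> = ctranspose X \<bullet> ctranspose (Y ** ctranspose Z)"
    by (simp add: inner_matrix_mult_left ctranspose_mult)
  finally show ?thesis by (simp add: inner_ctranspose)
qed

text \<open>Ideals are complex subspaces; orthogonal decomposition and \<open>dim\<close> are
  available for real ones.\<close>

lemma mtx_subspace_imp_subspace: "mtx.subspace S \<Longrightarrow> subspace S"
proof -
  assume S: "mtx.subspace S"
  have "c *\<^sub>R X = mscale (of_real c) X" for c and X :: "complex ^ 'a ^ 'a"
    unfolding vec_eq_iff mscale_def map_matrix_def by (simp add: scaleR_conv_of_real[where 'a = complex])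
  then show ?thesis
    using S by (simp add: subspace_def mtx.subspace_def)
qed

lemma mscale_mult_left: "mscale c X ** Y = mscale c (X ** Y)"
  by (simp add: mscale_def matrix_matrix_mult_def vec_eq_iff map_matrix_def sum_distrib_left mult.assoc)

lemma mscale_mult_right: "X ** mscale c Y = mscale c (X ** Y)"
  by (simp add: mscale_def matrix_matrix_mult_def vec_eq_iff map_matrix_def sum_distrib_left
      mult.left_commute)

lemma matrix_add_rdistrib: "((Y :: 'b::semiring_1 ^ _ ^ _) + Z) ** X = Y ** X + Z ** X"
  by (simp add: matrix_matrix_mult_def vec_eq_iff sum.distrib algebra_simps)

lemma matrix_mult_sum_right: "X ** sum f S = (\<Sum>s\<in>S. X ** f s)"
  by (induction S rule: infinite_finite_induct) (auto simp: matrix_add_ldistrib)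

lemma matrix_mult_sum_left: "sum f S ** X = (\<Sum>s\<in>S. f s ** X)"
  by (induction S rule: infinite_finite_induct) (auto simp: matrix_add_rdistrib)

lemma matrix_diff_ldistrib: "(X :: 'b::ring_1 ^ _ ^ _) ** (Y - Z) = X ** Y - X ** Z"
  by (simp add: matrix_matrix_mult_def vec_eq_iff sum_subtractf algebra_simps)

lemma matrix_diff_rdistrib: "((Y :: 'b::ring_1 ^ _ ^ _) - Z) ** X = Y ** X - Z ** X"
  by (simp add: matrix_matrix_mult_def vec_eq_iff sum_subtractf algebra_simps)

section \<open>Ideals and their units in star-closed matrix algebras\<close>

locale matrix_star_algebra =
  fixes A :: "(complex ^ 'a ^ 'a :: finite) set"
  assumes subspace: "mtx.subspace A"
    and mult_closed: "X \<in> A \<Longrightarrow> Y \<in> A \<Longrightarrow> X ** Y \<in> A"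
    and ctranspose_closed: "X \<in> A \<Longrightarrow> ctranspose X \<in> A"
    and one_mem: "mat 1 \<in> A"
begin

lemmas diff_closed = mtx.subspace_diff[OF subspace]

text \<open>The unit \<open>e\<close> is the orthogonal projection of the identity matrix onto
  \<open>I\<close>. The remainder \<open>f\<close> is orthogonal to \<open>I\<close>, and this
  forces \<open>f\<close> to annihilate \<open>I\<close> from both sides.\<close>

lemma ideal_identity:
  assumes I: "two_sided_ideal A I"
  obtains e where "e \<in> I" "\<And>X. X \<in> I \<Longrightarrow> e ** X = X" "\<And>X. X \<in> I \<Longrightarrow> X ** e = X"
    "ctranspose e = e" "\<And>X. X \<in> A \<Longrightarrow> e ** X = X ** e"
proof -
  have sub: "subspace I" and IA: "I \<subseteq> A"
    and left: "\<And>X Y. X \<in> A \<Longrightarrow> Y \<in> I \<Longrightarrow> X ** Y \<in> I"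
    and right: "\<And>X Y. X \<in> A \<Longrightarrow> Y \<in> I \<Longrightarrow> Y ** X \<in> I"
    using I mtx_subspace_imp_subspace by (auto simp: two_sided_ideal_def)
  obtain e f where e: "e \<in> span I" and f: "\<And>w. w \<in> span I \<Longrightarrow> orthogonal f w"
    and ef: "mat 1 = e + f"
    using orthogonal_subspace_decomp_exists[of I "mat 1"] by metis
  have e: "e \<in> I" using e sub by (metis span_eq_iff)
  have f0: "f \<bullet> Y = 0" if "Y \<in> I" for Y
    using f[of Y] that by (simp add: orthogonal_def span_base)
  have feq: "f = mat 1 - e" using ef by simp
  have fA: "f \<in> A" unfolding feq using e IA one_mem diff_closed by blast
  have lid: "e ** X = X" if X: "X \<in> I" for X
  proof -
    \<comment> \<open>The product on the right of the inner product lies in \<open>I\<close>,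
      because \<open>X\<close> does, so the squared norm of \<open>f ** X\<close> is zero.\<close>
    have "(f ** X) \<bullet> (f ** X) = f \<bullet> ((f ** X) ** ctranspose X)"
      by (rule inner_matrix_mult_right)
    also have "\<dots> = 0"
      using X IA fA left right ctranspose_closed by (intro f0) blast
    finally have "f ** X = 0" by simp
    then show ?thesis by (simp add: feq matrix_diff_rdistrib)
  qed
  have rid: "X ** e = X" if X: "X \<in> I" for X
  proof -
    have "(X ** f) \<bullet> (X ** f) = f \<bullet> (ctranspose X ** (X ** f))"
      by (rule inner_matrix_mult_left)
    also have "\<dots> = 0"
      using X IA fA left right ctranspose_closed by (intro f0) blast
    finally have "X ** f = 0" by simp
    then show ?thesis by (simp add: feq matrix_diff_ldistrib)
  qed
  \<comment> \<open>It is not yet known that \<open>ctranspose e\<close> lies in \<open>I\<close>;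
    the factor \<open>e\<close> in front already puts the product into \<open>I\<close>. The outcome
    \<open>ctranspose e = ctranspose e ** e\<close> has a Hermitian right-hand side, so
    \<open>e\<close> is Hermitian.\<close>
  have "(ctranspose e ** f) \<bullet> (ctranspose e ** f) = f \<bullet> (e ** (ctranspose e ** f))"
    by (simp add: inner_matrix_mult_left)
  also have "\<dots> = 0"
    using e IA fA right ctranspose_closed mult_closed by (intro f0) blast
  finally have "ctranspose e ** f = 0" by simp
  then have star: "ctranspose e = ctranspose e ** e" by (simp add: feq matrix_diff_ldistrib)
  then have "e = ctranspose e ** e" by (metis ctranspose_ctranspose ctranspose_mult)
  with star have "ctranspose e = e" by simp
  \<comment> \<open>Both \<open>X ** e\<close> and \<open>e ** X\<close> lie in \<open>I\<close>, so
    both equal \<open>e ** X ** e\<close>.\<close>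
  moreover have "e ** X = X ** e" if "X \<in> A" for X
    using lid[OF left[OF that e]] rid[OF right[OF that e]] by (simp add: matrix_mul_assoc)
  ultimately show ?thesis using that e lid rid by blast
qed

definition minimal_ideal :: "(complex ^ 'a ^ 'a) set \<Rightarrow> bool" where
  "minimal_ideal B \<longleftrightarrow> two_sided_ideal A B \<and> B \<noteq> {0} \<and>
     (\<forall>I. two_sided_ideal A I \<and> I \<subseteq> B \<longrightarrow> I = {0} \<or> I = B)"

lemma two_sided_ideal_zero_mem: "two_sided_ideal A I \<Longrightarrow> 0 \<in> I"
  by (simp add: two_sided_ideal_def mtx.subspace_0)

lemma two_sided_ideal_inter:
  "two_sided_ideal A I \<Longrightarrow> two_sided_ideal A J \<Longrightarrow> two_sided_ideal A (I \<inter> J)"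
  by (auto simp: two_sided_ideal_def mtx.subspace_inter)

lemma minimal_ideals_disjoint:
  assumes "minimal_ideal B" "minimal_ideal C" "B \<noteq> C"
  shows "B \<inter> C = {0}"
proof -
  have "two_sided_ideal A (B \<inter> C)"
    using assms two_sided_ideal_inter by (auto simp: minimal_ideal_def)
  then show ?thesis using assms unfolding minimal_ideal_def
    by (metis inf.cobounded1 inf.cobounded2)
qed

text \<open>Take a nonzero ideal inside \<open>I\<close> of least real dimension: a nonzero ideal
  contained in it has the same dimension and therefore equals it.\<close>

lemma contains_minimal_ideal:
  assumes I: "two_sided_ideal A I" "I \<noteq> {0}"
  obtains B where "minimal_ideal B" "B \<subseteq> I"
proof -
  obtain B where B: "two_sided_ideal A B" "B \<noteq> {0}" "B \<subseteq> I"
    and least: "\<And>J. two_sided_ideal A J \<Longrightarrow> J \<noteq> {0} \<Longrightarrow> J \<subseteq> I \<Longrightarrow> dim B \<le> dim J"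
    using ex_has_least_nat[of "\<lambda>J. two_sided_ideal A J \<and> J \<noteq> {0} \<and> J \<subseteq> I" I dim] I
    by blast
  have "J = B" if "two_sided_ideal A J" "J \<subseteq> B" "J \<noteq> {0}" for J
  proof (rule subspace_dim_equal)
    show "subspace J" "subspace B"
      using that B mtx_subspace_imp_subspace by (auto simp: two_sided_ideal_def)
    show "J \<subseteq> B" "dim B \<le> dim J" using that B least by auto
  qed
  then have "minimal_ideal B" using B by (auto simp: minimal_ideal_def)
  then show ?thesis using B that by blast
qed

definition ideal_unit :: "(complex ^ 'a ^ 'a) set \<Rightarrow> complex ^ 'a ^ 'a" where
  "ideal_unit I = (SOME e. identity_element I e \<and> ctranspose e = e \<and> (\<forall>X\<in>A. e ** X = X ** e))"

lemma ideal_unit: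
  assumes "two_sided_ideal A I"
  shows "identity_element I (ideal_unit I)" "ctranspose (ideal_unit I) = ideal_unit I"
    "X \<in> A \<Longrightarrow> ideal_unit I ** X = X ** ideal_unit I"
proof -
  have "\<exists>e. identity_element I e \<and> ctranspose e = e \<and> (\<forall>X\<in>A. e ** X = X ** e)"
    using ideal_identity[OF assms] unfolding identity_element_def by metis
  then have "identity_element I (ideal_unit I) \<and> ctranspose (ideal_unit I) = ideal_unit I
     \<and> (\<forall>X\<in>A. ideal_unit I ** X = X ** ideal_unit I)"
    unfolding ideal_unit_def by (rule someI_ex)
  then show "identity_element I (ideal_unit I)" "ctranspose (ideal_unit I) = ideal_unit I"
    "X \<in> A \<Longrightarrow> ideal_unit I ** X = X ** ideal_unit I" by auto
qed

lemma ideal_unit_mem: "two_sided_ideal A I \<Longrightarrow> ideal_unit I \<in> I"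
  using ideal_unit(1) by (auto simp: identity_element_def)

lemma ideal_unit_left: "two_sided_ideal A I \<Longrightarrow> X \<in> I \<Longrightarrow> ideal_unit I ** X = X"
  and ideal_unit_right: "two_sided_ideal A I \<Longrightarrow> X \<in> I \<Longrightarrow> X ** ideal_unit I = X"
  using ideal_unit(1) by (auto simp: identity_element_def)

lemma ideal_unit_nonzero:
  assumes "two_sided_ideal A I" "I \<noteq> {0}"
  shows "ideal_unit I \<noteq> 0"
proof
  assume "ideal_unit I = 0"
  then have "X = 0" if "X \<in> I" for X using ideal_unit_left[OF assms(1) that] by simp
  then show False using assms two_sided_ideal_zero_mem by blast
qed

lemma minimal_ideal_mult_eq_0:
  assumes "minimal_ideal B" "minimal_ideal C" "B \<noteq> C" "X \<in> B" "Y \<in> C"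
  shows "X ** Y = 0"
proof -
  have ideal: "two_sided_ideal A B" "two_sided_ideal A C"
    using assms by (simp_all add: minimal_ideal_def)
  then have "X \<in> A" "Y \<in> A" using assms(4,5) by (auto simp: two_sided_ideal_def)
  then have "X ** Y \<in> B \<inter> C" using ideal assms(4,5) by (auto simp: two_sided_ideal_def)
  then show ?thesis using minimal_ideals_disjoint[OF assms(1-3)] by simp
qed

text \<open>The units of distinct minimal ideals are nonzero and pairwise orthogonal, hence linearly
  independent in a finite-dimensional space.\<close>

lemma finite_minimal_ideals: "finite (Collect minimal_ideal)"
proof -
  have ideal: "two_sided_ideal A B" if "minimal_ideal B" for B
    using that by (simp add: minimal_ideal_def)
  have nz: "ideal_unit B \<noteq> 0" if "minimal_ideal B" for B
    using that ideal_unit_nonzero by (simp add: minimal_ideal_def)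
  have prod0: "ideal_unit B ** ideal_unit C = 0"
    if "minimal_ideal B" "minimal_ideal C" "B \<noteq> C" for B C
    using minimal_ideal_mult_eq_0 that ideal ideal_unit_mem by blast
  have orth: "ideal_unit B \<bullet> ideal_unit C = 0"
    if "minimal_ideal B" "minimal_ideal C" "B \<noteq> C" for B C
  proof -
    have "ideal_unit B \<bullet> ideal_unit C = (ideal_unit B ** ideal_unit B) \<bullet> ideal_unit C"
      using that ideal ideal_unit_mem ideal_unit_left by metis
    also have "\<dots> = 0"
      unfolding inner_matrix_mult_left using that ideal ideal_unit(2) prod0 by simp
    finally show ?thesis .
  qed
  have "pairwise orthogonal (ideal_unit ` Collect minimal_ideal)"
    using orth by (auto simp: pairwise_def orthogonal_def)
  moreover have "0 \<notin> ideal_unit ` Collect minimal_ideal" using nz by auto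
  ultimately have "finite (ideal_unit ` Collect minimal_ideal)"
    using pairwise_orthogonal_independent independent_imp_finite by blast
  moreover have "inj_on ideal_unit (Collect minimal_ideal)"
  proof (rule inj_onI)
    fix B C assume B: "B \<in> Collect minimal_ideal" and C: "C \<in> Collect minimal_ideal"
      and "ideal_unit B = ideal_unit C"
    then have "ideal_unit B \<bullet> ideal_unit C \<noteq> 0" using nz by simp
    then show "B = C" using orth B C by blast
  qed
  ultimately show ?thesis by (rule finite_imageD)
qed

text \<open>If the sum \<open>e\<close> of the units were not the identity, the annihilator of
  \<open>e\<close> would be a nonzero ideal, as it contains \<open>mat 1 - e\<close>. It would then
  contain a minimal ideal, whose unit is both fixed and killed by \<open>e\<close>.\<close>

lemma sum_ideal_unit: "(\<Sum>B | minimal_ideal B. ideal_unit B) = mat 1"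
proof (rule ccontr)
  define e where "e = (\<Sum>B | minimal_ideal B. ideal_unit B)"
  assume "(\<Sum>B | minimal_ideal B. ideal_unit B) \<noteq> mat 1"
  then have ne: "mat 1 - e \<noteq> 0" by (simp add: e_def)
  have ideal: "two_sided_ideal A B" if "minimal_ideal B" for B
    using that by (simp add: minimal_ideal_def)
  have eA: "e \<in> A"
    unfolding e_def
  proof (rule mtx.subspace_sum[OF subspace])
    fix B assume "B \<in> Collect minimal_ideal"
    then have "two_sided_ideal A B" "ideal_unit B \<in> B" using ideal ideal_unit_mem by auto
    then show "ideal_unit B \<in> A" by (auto simp: two_sided_ideal_def)
  qed
  have comm: "e ** X = X ** e" if "X \<in> A" for X
    unfolding e_def matrix_mult_sum_left matrix_mult_sum_right
    using that ideal ideal_unit(3) by (intro sum.cong) auto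
  have eB: "e ** ideal_unit B = ideal_unit B" if B: "minimal_ideal B" for B
  proof -
    have "e ** ideal_unit B = (\<Sum>C | minimal_ideal C. if C = B then ideal_unit B else 0)"
      unfolding e_def matrix_mult_sum_left
    proof (rule sum.cong[OF refl])
      fix C assume "C \<in> Collect minimal_ideal"
      then show "ideal_unit C ** ideal_unit B = (if C = B then ideal_unit B else 0)"
        using B ideal ideal_unit_mem ideal_unit_left minimal_ideal_mult_eq_0 by auto
    qed
    then show ?thesis using B finite_minimal_ideals by simp
  qed
  define I where "I = {X \<in> A. e ** X = 0}"
  have "two_sided_ideal A I"
    unfolding two_sided_ideal_def
  proof (intro conjI ballI)
    show "I \<subseteq> A" by (auto simp: I_def)
    show "mtx.subspace I"
      using subspace by (auto simp: I_def mtx.subspace_def matrix_add_ldistrib mscale_mult_right)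
    fix X Y assume "X \<in> A" "Y \<in> I"
    then show "X ** Y \<in> I" "Y ** X \<in> I"
      using comm[of X] mult_closed by (auto simp: I_def matrix_mul_assoc)
        (simp flip: matrix_mul_assoc)
  qed
  \<comment> \<open>Only the right factor and the right-hand side are expanded, so that
    \<open>eB\<close> applies to each summand.\<close>
  moreover have "e ** e = e"
    by (subst (2 3) e_def) (simp add: matrix_mult_sum_right eB)
  then have "mat 1 - e \<in> I"
    using eA one_mem diff_closed by (simp add: I_def matrix_diff_ldistrib)
  then have "I \<noteq> {0}" using ne by blast
  ultimately obtain B where B: "minimal_ideal B" "B \<subseteq> I" by (rule contains_minimal_ideal)
  then have "ideal_unit B \<in> I" using ideal ideal_unit_mem by blast
  then have "ideal_unit B = 0" using eB B by (simp add: I_def)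
  then show False using B ideal_unit_nonzero by (simp add: minimal_ideal_def)
qed

text \<open>An ideal of \<open>B\<close> is already an ideal of \<open>A\<close>: multiplying one of
  its elements by \<open>X\<close> amounts to multiplying it by \<open>X ** ideal_unit B\<close> or
  \<open>ideal_unit B ** X\<close>, which lie in \<open>B\<close>. Minimality then leaves only the
  two trivial ideals.\<close>

lemma minimal_ideal_imp_simple_algebra:
  assumes B: "minimal_ideal B"
  shows "simple_algebra B"
proof -
  have ideal: "two_sided_ideal A B" using B by (simp add: minimal_ideal_def)
  have nz: "ideal_unit B ** ideal_unit B \<noteq> 0"
    using B ideal ideal_unit_nonzero ideal_unit_left ideal_unit_mem
    by (simp add: minimal_ideal_def)
  have "two_sided_ideal A I" if I: "two_sided_ideal B I" for I
    unfolding two_sided_ideal_def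
  proof (intro conjI ballI)
    show "I \<subseteq> A" "mtx.subspace I" using ideal I by (auto simp: two_sided_ideal_def)
    fix X Y assume X: "X \<in> A" and Y: "Y \<in> I"
    then have "Y \<in> B" using I by (auto simp: two_sided_ideal_def)
    then have "X ** Y = (X ** ideal_unit B) ** Y" "Y ** X = Y ** (ideal_unit B ** X)"
      using ideal by (simp_all add: ideal_unit_left ideal_unit_right matrix_mul_assoc flip: matrix_mul_assoc[of X])
    moreover have "X ** ideal_unit B \<in> B" "ideal_unit B ** X \<in> B"
      using ideal X ideal_unit_mem by (auto simp: two_sided_ideal_def)
    ultimately show "X ** Y \<in> I" "Y ** X \<in> I"
      using I Y by (auto simp: two_sided_ideal_def)
  qed
  moreover have "I \<subseteq> B" if "two_sided_ideal B I" for I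
    using that by (simp add: two_sided_ideal_def)
  ultimately have "\<forall>I. two_sided_ideal B I \<longrightarrow> I = {0} \<or> I = B"
    using B by (auto simp: minimal_ideal_def)
  then show ?thesis
    unfolding simple_algebra_def using nz ideal ideal_unit_mem by blast
qed

text \<open>The component of \<open>X\<close> in \<open>B\<close> is
  \<open>X ** ideal_unit B\<close>. It is unique because multiplying any decomposition by
  \<open>ideal_unit B\<close> kills all other components.\<close>

lemma simple_decomposition_minimal_ideals: "simple_decomposition A (Collect minimal_ideal)"
proof -
  have ideal: "two_sided_ideal A B" if "minimal_ideal B" for B
    using that by (simp add: minimal_ideal_def)
  have ex1: "\<exists>!f. f \<in> (\<Pi>\<^sub>E B\<in>Collect minimal_ideal. B) \<and> X = (\<Sum>B\<in>Collect minimal_ideal. f B)"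
    if X: "X \<in> A" for X
  proof (rule ex1I[of _ "\<lambda>B\<in>Collect minimal_ideal. X ** ideal_unit B"], intro conjI)
    show "(\<lambda>B\<in>Collect minimal_ideal. X ** ideal_unit B) \<in> (\<Pi>\<^sub>E B\<in>Collect minimal_ideal. B)"
      using X ideal ideal_unit_mem by (auto simp: two_sided_ideal_def)
    have "X = (\<Sum>B | minimal_ideal B. X ** ideal_unit B)"
      by (simp add: sum_ideal_unit flip: matrix_mult_sum_right)
    then show "X = (\<Sum>C | minimal_ideal C. (\<lambda>B\<in>Collect minimal_ideal. X ** ideal_unit B) C)"
      by simp
  next
    fix f assume f: "f \<in> (\<Pi>\<^sub>E B\<in>Collect minimal_ideal. B) \<and> X = (\<Sum>B | minimal_ideal B. f B)"
    show "f = (\<lambda>B\<in>Collect minimal_ideal. X ** ideal_unit B)"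
    proof
      fix B
      show "f B = (\<lambda>B\<in>Collect minimal_ideal. X ** ideal_unit B) B"
      proof (cases "minimal_ideal B")
        case True
        have "X ** ideal_unit B = (\<Sum>C | minimal_ideal C. f C ** ideal_unit B)"
          using f by (simp add: matrix_mult_sum_left)
        also have "\<dots> = (\<Sum>C | minimal_ideal C. if C = B then f B else 0)"
        proof (rule sum.cong[OF refl])
          fix C assume C: "C \<in> Collect minimal_ideal"
          then have "f C \<in> C" using f by auto
          then show "f C ** ideal_unit B = (if C = B then f B else 0)"
            using C True ideal ideal_unit_mem ideal_unit_right minimal_ideal_mult_eq_0
            by auto
        qed
        finally show ?thesis using True finite_minimal_ideals by simp
      next
        case False
        then show ?thesis using f by (auto simp: PiE_def extensional_def)
      qed
    qed
  qed
  show ?thesis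
    unfolding simple_decomposition_def
    using finite_minimal_ideals ideal minimal_ideal_imp_simple_algebra ex1 by simp
qed

lemma ideal_unit_central_primitive:
  assumes "minimal_ideal B"
  shows "ideal_unit B \<in> central_primitive_idempotents A"
proof -
  have "identity_element B (ideal_unit B)"
    using assms ideal_unit(1) by (simp add: minimal_ideal_def)
  then show ?thesis
    unfolding central_primitive_idempotents_def
    using simple_decomposition_minimal_ideals assms by blast
qed

end

section \<open>Primitive idempotents of commutative algebras\<close>

text \<open>With \<open>J\<close> the all-ones matrix, \<open>J M J\<close> is the sum of all
  entries of \<open>M\<close> times \<open>J\<close>.\<close>

lemma trivial_idempotent_sandwich:
  fixes M :: "complex ^ 'a ^ 'a :: finite"
  obtains c where "trivial_idempotent ** M ** trivial_idempotent = mscale c trivial_idempotent"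
proof
  show "trivial_idempotent ** M ** trivial_idempotent =
      mscale ((\<Sum>i\<in>UNIV. \<Sum>j\<in>UNIV. M $ i $ j) / of_nat CARD('a)) trivial_idempotent"
    unfolding sum.swap[of "\<lambda>i j. M $ i $ j" UNIV UNIV]
    by (simp add: trivial_idempotent_def mscale_def map_matrix_def matrix_matrix_mult_def
        vec_eq_iff flip: sum_divide_distrib)
qed

lemma trivial_idempotent_idem:
  "trivial_idempotent ** trivial_idempotent = (trivial_idempotent :: complex ^ 'a ^ 'a :: finite)"
  by (simp add: trivial_idempotent_def matrix_matrix_mult_def vec_eq_iff)

locale commutative_matrix_star_algebra = matrix_star_algebra +
  assumes commute: "X \<in> A \<Longrightarrow> Y \<in> A \<Longrightarrow> X ** Y = Y ** X"
begin

text \<open>Otherwise \<open>e ** F\<close> and \<open>F - e ** F\<close> would split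
  \<open>F\<close> into two nonzero orthogonal idempotents.\<close>

lemma primitive_idempotent_mult:
  assumes F: "F \<in> primitive_idempotents A" and e: "e \<in> A" "e ** e = e"
  shows "e ** F = 0 \<or> e ** F = F"
proof (rule ccontr)
  let ?P = "e ** F" and ?Q = "F - e ** F"
  assume "\<not> (e ** F = 0 \<or> e ** F = F)"
  then have nz: "?P \<noteq> 0" "?Q \<noteq> 0" by auto
  have FA: "F \<in> A" and FF: "F ** F = F" using F by (auto simp: primitive_idempotents_def)
  have PA: "?P \<in> A" using FA e mult_closed by blast
  have QA: "?Q \<in> A" using FA PA diff_closed by blast
  have FP: "F ** ?P = ?P" "?P ** F = ?P"
    using commute[OF FA PA] by (simp_all add: FF flip: matrix_mul_assoc)
  have "?P ** ?P = e ** (F ** ?P)" by (simp add: matrix_mul_assoc)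
  also have "\<dots> = e ** e ** F" unfolding FP by (rule matrix_mul_assoc)
  finally have PP: "?P ** ?P = ?P" by (simp add: e)
  have "?P ** ?Q = 0" "?Q ** ?P = 0" "?Q ** ?Q = ?Q"
    by (simp_all add: matrix_diff_ldistrib matrix_diff_rdistrib FP PP FF)
  moreover have "F = ?P + ?Q" by simp
  ultimately show False
    using F nz PA QA PP unfolding primitive_idempotents_def by blast
qed

text \<open>The unit \<open>e\<close> of the annihilator of \<open>X\<close> either kills or fixes
  \<open>F\<close>. In the first case \<open>Y = Y ** e\<close> gives \<open>Y ** F = 0\<close>; in
  the second \<open>X ** e = 0\<close> gives \<open>X ** F = 0\<close>.\<close>

lemma primitive_idempotent_annihilates:
  assumes F: "F \<in> primitive_idempotents A" and X: "X \<in> A" and Y: "Y \<in> A" and "X ** Y = 0"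
  shows "X ** F = 0 \<or> Y ** F = 0"
proof -
  define I where "I = {Z \<in> A. X ** Z = 0}"
  have ideal: "two_sided_ideal A I"
    unfolding two_sided_ideal_def
  proof (intro conjI ballI)
    show "I \<subseteq> A" by (auto simp: I_def)
    show "mtx.subspace I"
      using subspace by (auto simp: I_def mtx.subspace_def matrix_add_ldistrib mscale_mult_right)
    fix W Z assume W: "W \<in> A" and Z: "Z \<in> I"
    then have "X ** (Z ** W) = 0" by (simp add: I_def matrix_mul_assoc)
    then show "Z ** W \<in> I" using W Z mult_closed by (simp add: I_def)
    then show "W ** Z \<in> I" using W Z commute[of W Z] by (simp add: I_def)
  qed
  define e where "e = ideal_unit I"
  have eI: "e \<in> I" unfolding e_def by (rule ideal_unit_mem[OF ideal])
  have eA: "e \<in> A" using eI by (simp add: I_def)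
  have FA: "F \<in> A" using F by (simp add: primitive_idempotents_def)
  have "Y \<in> I" using Y assms(4) by (simp add: I_def)
  then have Ye: "Y ** e = Y" unfolding e_def by (rule ideal_unit_right[OF ideal])
  have "e ** e = e" using eI ideal_unit_left[OF ideal] by (simp add: e_def)
  then consider "e ** F = 0" | "e ** F = F"
    using primitive_idempotent_mult[OF F eA] by blast
  then show ?thesis
  proof cases
    case 1
    have "Y ** F = Y ** (e ** F)" by (simp add: Ye matrix_mul_assoc)
    then show ?thesis using 1 by simp
  next
    case 2
    have "X ** F = X ** e ** F" by (simp add: 2 flip: matrix_mul_assoc)
    also have "X ** e = 0" using eI by (simp add: I_def)
    finally show ?thesis by simp
  qed
qed

text \<open>Otherwise \<open>F\<close> is fixed by \<open>trivial_idempotent\<close> on both sides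
  and so is a scalar multiple of it; idempotence forces the scalar to be 1.\<close>

lemma primitive_idempotent_mult_trivial:
  assumes F: "F \<in> primitive_idempotents A" and "F \<noteq> trivial_idempotent"
    and E: "trivial_idempotent \<in> A"
  shows "trivial_idempotent ** F = 0"
proof (rule ccontr)
  let ?E = "trivial_idempotent :: complex ^ 'a ^ 'a"
  assume "?E ** F \<noteq> 0"
  then have EF: "?E ** F = F"
    using primitive_idempotent_mult[OF F E trivial_idempotent_idem] by blast
  have FA: "F \<in> A" and FF: "F ** F = F" and nz: "F \<noteq> 0"
    using F by (auto simp: primitive_idempotents_def)
  have "?E ** F ** ?E = F" using EF commute[OF E FA] by simp
  then obtain c where c: "F = mscale c ?E"
    using trivial_idempotent_sandwich[of F] by metis
  have "mscale c F = mscale c ?E ** F" by (simp add: mscale_mult_left EF)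
  also have "\<dots> = F" using c FF by simp
  finally have "mscale (c - 1) F = 0" by (simp add: mtx.scale_left_diff_distrib)
  then have "c = 1" using nz by simp
  then show False using c assms(2) by simp
qed

text \<open>If \<open>P = p + q\<close> were a splitting, the annihilator of \<open>p\<close> in the
  simple algebra \<open>B\<close> would be an ideal containing \<open>q\<close>, hence all of
  \<open>B\<close>, and so \<open>p ** p\<close> would vanish.\<close>

lemma central_primitive_imp_primitive:
  "central_primitive_idempotents A \<subseteq> primitive_idempotents A"
proof
  fix P assume "P \<in> central_primitive_idempotents A"
  then obtain B where ideal: "two_sided_ideal A B" and simple: "simple_algebra B"
    and unit: "identity_element B P"
    unfolding central_primitive_idempotents_def simple_decomposition_def by blast
  have BA: "B \<subseteq> A" using ideal by (simp add: two_sided_ideal_def)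
  have PB: "P \<in> B" and PP: "P ** P = P" and left: "\<And>X. X \<in> B \<Longrightarrow> P ** X = X"
    using unit by (auto simp: identity_element_def)
  have nz: "P \<noteq> 0"
  proof
    assume "P = 0"
    then have "X = 0" if "X \<in> B" for X using left[OF that] by simp
    then show False using simple by (fastforce simp: simple_algebra_def)
  qed
  have False
    if p: "p \<in> A" "p \<noteq> 0" "p ** p = p" and q: "q \<in> A" "q \<noteq> 0" "q ** q = q"
      and pq: "p ** q = 0" "q ** p = 0" and P: "P = p + q" for p q
  proof -
    have "p ** P = p" "q ** P = q" by (simp_all add: P matrix_add_ldistrib p q pq)
    then have pB: "p \<in> B" and qB: "q \<in> B"
      using ideal p(1) q(1) PB unfolding two_sided_ideal_def by metis+
    define I where "I = {Z \<in> B. p ** Z = 0}"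
    have "two_sided_ideal B I"
      unfolding two_sided_ideal_def
    proof (intro conjI ballI)
      show "I \<subseteq> B" by (auto simp: I_def)
      show "mtx.subspace I"
        using ideal by (auto simp: two_sided_ideal_def I_def mtx.subspace_def
            matrix_add_ldistrib mscale_mult_right)
      fix W Z assume W: "W \<in> B" and Z: "Z \<in> I"
      then have "p ** (Z ** W) = 0" by (simp add: I_def matrix_mul_assoc)
      moreover have "Z ** W \<in> B" "W ** Z = Z ** W"
        using W Z ideal BA commute[of W Z] by (auto simp: I_def two_sided_ideal_def)
      ultimately show "Z ** W \<in> I" "W ** Z \<in> I" by (simp_all add: I_def)
    qed
    moreover have "q \<in> I" using qB pq by (simp add: I_def)
    ultimately have "I = B" using simple q(2) unfolding simple_algebra_def by blast
    then have "p ** p = 0" using pB by (auto simp: I_def)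
    then show False using p by simp
  qed
  then show "P \<in> primitive_idempotents A"
    using PB BA PP nz unfolding primitive_idempotents_def by blast
qed

end

section \<open>Adjacency algebras described by entries\<close>

lemma adjacency_algebra_eq:
  assumes C: "partition_on UNIV C"
  shows "adjacency_algebra C =
    {M. \<forall>R\<in>C. \<forall>i j k l. (i, j) \<in> R \<longrightarrow> (k, l) \<in> R \<longrightarrow> M $ i $ j = M $ k $ l}" (is "_ = ?S")
proof
  have sub: "mtx.subspace ?S"
  proof (rule mtx.subspaceI)
    show "0 \<in> ?S" by simp
    fix X Y c assume X: "X \<in> ?S" and Y: "Y \<in> ?S"
    have X': "X $ i $ j = X $ k $ l" and Y': "Y $ i $ j = Y $ k $ l"
      if "R \<in> C" "(i, j) \<in> R" "(k, l) \<in> R" for R i j k l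
      using X[unfolded mem_Collect_eq, rule_format, OF that]
        Y[unfolded mem_Collect_eq, rule_format, OF that] .
    show "X + Y \<in> ?S"
      unfolding mem_Collect_eq
    proof (intro ballI allI impI)
      fix R i j k l assume "R \<in> C" "(i, j) \<in> R" "(k, l) \<in> R"
      then show "(X + Y) $ i $ j = (X + Y) $ k $ l" using X'[of R i j k l] Y'[of R i j k l] by simp
    qed
    show "mscale c X \<in> ?S"
      unfolding mem_Collect_eq
    proof (intro ballI allI impI)
      fix R i j k l assume "R \<in> C" "(i, j) \<in> R" "(k, l) \<in> R"
      then show "mscale c X $ i $ j = mscale c X $ k $ l"
        using X'[of R i j k l] by (simp add: mscale_def map_matrix_def)
    qed
  qed
  have "adjacency_matrix ` C \<subseteq> ?S"
    unfolding image_subset_iff mem_Collect_eq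
  proof (intro ballI allI impI)
    fix R S i j k l assume "R \<in> C" "S \<in> C" "(i, j) \<in> S" "(k, l) \<in> S"
    then show "adjacency_matrix R $ i $ j = adjacency_matrix R $ k $ l"
      using disjointD[OF partition_onD2[OF C], of R S]
      by (cases "R = S") (auto simp: adjacency_matrix_def)
  qed
  then show "adjacency_algebra C \<subseteq> ?S"
    unfolding adjacency_algebra_def using sub by (rule mtx.span_minimal)
  show "?S \<subseteq> adjacency_algebra C"
  proof
    fix M assume M: "M \<in> ?S"
    \<comment> \<open>A representative pair of each class: the entry of \<open>M\<close> there is
      the coefficient of the class in the linear combination.\<close>
    define p where "p R = (SOME x. x \<in> R)" for R :: "('a \<times> 'a) set"
    have p: "p R \<in> R" if "R \<in> C" for R
      using partition_onD3[OF C] that unfolding p_def by (metis some_in_eq)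
    define c where "c R = M $ fst (p R) $ snd (p R)" for R
    have "M $ i $ j = (\<Sum>R\<in>C. mscale (c R) (adjacency_matrix R)) $ i $ j" for i j
    proof -
      obtain R where R: "R \<in> C" "(i, j) \<in> R"
        using partition_onD1[OF C] by blast
      have "(i, j) \<in> S \<longleftrightarrow> S = R" if "S \<in> C" for S
        using disjointD[OF partition_onD2[OF C] R(1) that] R(2) by auto
      then have "(\<Sum>S\<in>C. mscale (c S) (adjacency_matrix S)) $ i $ j =
          (\<Sum>S\<in>C. if S = R then c S else 0)"
        unfolding sum_component
        by (intro sum.cong refl) (simp add: mscale_def map_matrix_def adjacency_matrix_def)
      also have "\<dots> = c R" using R by simp
      also have "c R = M $ i $ j"
        using M[unfolded mem_Collect_eq, rule_format, OF R(1) _ R(2)] p[OF R(1)]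
        by (simp add: c_def)
      finally show ?thesis by simp
    qed
    then have "M = (\<Sum>R\<in>C. mscale (c R) (adjacency_matrix R))" by (simp add: vec_eq_iff)
    also have "\<dots> \<in> adjacency_algebra C"
      unfolding adjacency_algebra_def
      by (intro mtx.span_sum mtx.span_scale mtx.span_base) auto
    finally show "M \<in> adjacency_algebra C" .
  qed
qed

lemma adjacency_algebraD:
  assumes "partition_on UNIV C" "M \<in> adjacency_algebra C" "R \<in> C" "(i, j) \<in> R" "(k, l) \<in> R"
  shows "M $ i $ j = M $ k $ l"
  using assms(2)[unfolded adjacency_algebra_eq[OF assms(1)] mem_Collect_eq, rule_format, OF assms(3-5)] .

lemma adjacency_algebraI:
  assumes "partition_on UNIV C"
    and "\<And>R i j k l. R \<in> C \<Longrightarrow> (i, j) \<in> R \<Longrightarrow> (k, l) \<in> R \<Longrightarrow> M $ i $ j = M $ k $ l"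
  shows "M \<in> adjacency_algebra C"
  unfolding adjacency_algebra_eq[OF assms(1)] mem_Collect_eq using assms(2) by (intro ballI allI impI)

text \<open>The entries of a product of two adjacency matrices are intersection numbers, which
  coherence makes constant on each class. Span induction in each factor does the rest.\<close>

lemma adjacency_algebra_mult_closed:
  assumes C: "coherent_configuration C"
    and X: "X \<in> adjacency_algebra C" and Y: "Y \<in> adjacency_algebra C"
  shows "X ** Y \<in> adjacency_algebra C"
proof -
  have part: "partition_on UNIV C" using C by (simp add: coherent_configuration_def)
  have sub: "mtx.subspace (adjacency_algebra C)" by (simp add: adjacency_algebra_def)
  have base: "adjacency_matrix R ** adjacency_matrix S \<in> adjacency_algebra C"
    if RS: "R \<in> C" "S \<in> C" for R S
  proof -
    have entry: "(adjacency_matrix R ** adjacency_matrix S) $ i $ j =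
        of_nat (card {k. (i, k) \<in> R \<and> (k, j) \<in> S})" for i j
    proof -
      have "(adjacency_matrix R ** adjacency_matrix S) $ i $ j =
          (\<Sum>k\<in>UNIV. if k \<in> {k. (i, k) \<in> R \<and> (k, j) \<in> S} then 1 else 0)"
        by (auto simp: matrix_matrix_mult_def adjacency_matrix_def intro!: sum.cong)
      then show ?thesis by (simp only: sum.inter_filter[symmetric] finite) simp
    qed
    show ?thesis
      unfolding adjacency_algebra_eq[OF part]
    proof (simp only: mem_Collect_eq entry, intro ballI)
      fix T assume T: "T \<in> C"
      have cc: "\<forall>R\<in>C. \<forall>S\<in>C. \<forall>T\<in>C. \<exists>p. \<forall>(i, j)\<in>T. card {k. (i, k) \<in> R \<and> (k, j) \<in> S} = p"
        using C by (simp add: coherent_configuration_def)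
      obtain p where p: "\<forall>(i, j)\<in>T. card {k. (i, k) \<in> R \<and> (k, j) \<in> S} = p"
        using cc[THEN bspec, OF RS(1), THEN bspec, OF RS(2), THEN bspec, OF T] by (rule exE)
      have "card {k. (i, k) \<in> R \<and> (k, j) \<in> S} = p" if "(i, j) \<in> T" for i j
        using bspec[OF p that] by simp
      then show "\<forall>i j k l. (i, j) \<in> T \<longrightarrow> (k, l) \<in> T \<longrightarrow>
          complex_of_nat (card {k. (i, k) \<in> R \<and> (k, j) \<in> S}) =
          of_nat (card {ka. (k, ka) \<in> R \<and> (ka, l) \<in> S})"
        by simp
    qed
  qed
  have right: "adjacency_matrix R ** Z \<in> adjacency_algebra C"
    if R: "R \<in> C" and Z: "Z \<in> adjacency_algebra C" for R Z
    using Z[unfolded adjacency_algebra_def]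
  proof (induction rule: mtx.span_induct_alt)
    case base
    then show ?case using mtx.subspace_0[OF sub] by simp
  next
    case (step c x y)
    then show ?case
      using base[OF R] sub
      by (auto simp: matrix_add_ldistrib mscale_mult_right intro!: mtx.subspace_add mtx.subspace_scale)
  qed
  show ?thesis
    using X[unfolded adjacency_algebra_def]
  proof (induction rule: mtx.span_induct_alt)
    case base
    then show ?case using mtx.subspace_0[OF sub] by simp
  next
    case (step c x y)
    then show ?case
      using right[OF _ Y] sub
      by (auto simp: matrix_add_rdistrib mscale_mult_left intro!: mtx.subspace_add mtx.subspace_scale)
  qed
qed

section \<open>Orbitals of a transitive group and their algebras\<close>

locale transitive_group =
  fixes G :: "('a :: finite \<Rightarrow> 'a) set"
  assumes transitive_permutation_group: "transitive_permutation_group G"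
begin

lemma bij: "g \<in> G \<Longrightarrow> bij g"
  using transitive_permutation_group subgroup.subset[of G "BijGroup UNIV"]
  by (auto simp: transitive_permutation_group_def BijGroup_def Bij_def)

lemma mem_Bij: "g \<in> G \<Longrightarrow> g \<in> Bij UNIV"
  using bij by (simp add: Bij_def)

lemma comp_closed: "g \<in> G \<Longrightarrow> h \<in> G \<Longrightarrow> g \<circ> h \<in> G"
  using transitive_permutation_group subgroup.m_closed[of G "BijGroup UNIV" g h] mem_Bij
  by (auto simp: transitive_permutation_group_def BijGroup_def compose_def o_def restrict_def)

lemma id_mem: "(\<lambda>x. x) \<in> G"
  using transitive_permutation_group subgroup.one_closed[of G "BijGroup UNIV"]
  by (simp add: transitive_permutation_group_def BijGroup_def restrict_def)

lemma inv_closed: "g \<in> G \<Longrightarrow> inv_into UNIV g \<in> G"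
  using transitive_permutation_group subgroup.m_inv_closed[of G "BijGroup UNIV" g]
    inv_BijGroup[OF mem_Bij]
  by (simp add: transitive_permutation_group_def restrict_def)

lemma transitive: obtains g where "g \<in> G" "g i = j"
  using transitive_permutation_group transitive_action.unique_orbit[of "perm_group G" UNIV "\<lambda>g. g" i j]
  by (auto simp: transitive_permutation_group_def perm_group_def)

lemma inv_apply [simp]: "g \<in> G \<Longrightarrow> g (inv_into UNIV g i) = i" "g \<in> G \<Longrightarrow> inv_into UNIV g (g i) = i"
  using bij by (simp_all add: bij_is_surj surj_f_inv_f bij_is_inj)

lemma sum_comp_right:
  assumes "h \<in> G"
  shows "(\<Sum>g\<in>G. f (g \<circ> h)) = (\<Sum>g\<in>G. f g)"
  using assms by (intro sum.reindex_bij_witness[of _ "\<lambda>g. g \<circ> inv_into UNIV h" "\<lambda>g. g \<circ> h"])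
    (auto simp: comp_closed inv_closed fun_eq_iff)

lemma sum_apply: "g \<in> G \<Longrightarrow> (\<Sum>i\<in>UNIV. f (g i)) = (\<Sum>i\<in>UNIV. f i)"
  using sum.reindex_bij_betw[OF bij] by blast

lemma mem_orbital:
  assumes g: "g \<in> G" and R: "R \<in> orbitals G" and ij: "(i, j) \<in> R"
  shows "(g i, g j) \<in> R"
proof -
  obtain a b where R: "R = {map_prod h h (a, b) |h. h \<in> G}"
    using R by (auto simp: orbitals_def orbits_def orbit_def perm_group_def)
  then obtain h where h: "h \<in> G" "i = h a" "j = h b"
    using ij by auto
  then have "(g i, g j) = map_prod (g \<circ> h) (g \<circ> h) (a, b)" by simp
  then show ?thesis unfolding R using comp_closed[OF g h(1)] by blast
qed

lemma orbital_eq: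
  assumes "R \<in> orbitals G" "(i, j) \<in> R" "(k, l) \<in> R"
  obtains g where "g \<in> G" "k = g i" "l = g j"
proof -
  obtain a b g h where gh: "g \<in> G" "h \<in> G" "i = g a" "j = g b" "k = h a" "l = h b"
    using assms by (auto simp: orbitals_def orbits_def orbit_def perm_group_def)
  then have "k = (h \<circ> inv_into UNIV g) i" "l = (h \<circ> inv_into UNIV g) j" by simp_all
  then show ?thesis using that comp_closed inv_closed gh by blast
qed

lemma ex_orbital: obtains R where "R \<in> orbitals G" "(i, j) \<in> R"
proof
  show "orbit (perm_group G) (\<lambda>g. map_prod g g) (i, j) \<in> orbitals G"
    by (auto simp: orbitals_def orbits_def)
  show "(i, j) \<in> orbit (perm_group G) (\<lambda>g. map_prod g g) (i, j)"
    using id_mem by (force simp: orbit_def perm_group_def)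
qed

lemma partition_orbitals: "partition_on UNIV (orbitals G)"
proof (rule partition_onI)
  show "\<Union> (orbitals G) = UNIV"
    using ex_orbital by (metis UNIV_eq_I UnionI surj_pair)
  show "disjnt R S" if R: "R \<in> orbitals G" and S: "S \<in> orbitals G" and "R \<noteq> S" for R S
  proof (rule ccontr)
    assume "\<not> disjnt R S"
    then obtain i j where ij: "(i, j) \<in> R" "(i, j) \<in> S" by (auto simp: disjnt_def)
    have "(k, l) \<in> R \<longleftrightarrow> (k, l) \<in> S" for k l
      using orbital_eq[OF R ij(1)] orbital_eq[OF S ij(2)] mem_orbital R S ij by metis
    then show False using \<open>R \<noteq> S\<close> by auto
  qed
  show "{} \<notin> orbitals G"
    using id_mem by (auto simp: orbitals_def orbits_def orbit_def perm_group_def)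
qed

text \<open>The adjacency algebra of the orbitals is the centraliser algebra of the permutation
  representation: two pairs lie in one orbital exactly when some element of \<open>G\<close> maps
  one to the other.\<close>

lemma mem_adjacency_algebra_orbitals:
  "M \<in> adjacency_algebra (orbitals G) \<longleftrightarrow> (\<forall>g\<in>G. \<forall>i j. M $ g i $ g j = M $ i $ j)"
proof
  assume M: "M \<in> adjacency_algebra (orbitals G)"
  have "M $ g i $ g j = M $ i $ j" if g: "g \<in> G" for g i j
  proof -
    obtain R where R: "R \<in> orbitals G" "(i, j) \<in> R" by (rule ex_orbital)
    then show ?thesis using adjacency_algebraD[OF partition_orbitals M R(1) mem_orbital[OF g R]] by blast
  qed
  then show "\<forall>g\<in>G. \<forall>i j. M $ g i $ g j = M $ i $ j" by blast
next
  assume inv: "\<forall>g\<in>G. \<forall>i j. M $ g i $ g j = M $ i $ j"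
  show "M \<in> adjacency_algebra (orbitals G)"
  proof (rule adjacency_algebraI[OF partition_orbitals])
    fix R i j k l assume "R \<in> orbitals G" "(i, j) \<in> R" "(k, l) \<in> R"
    then obtain g where "g \<in> G" "k = g i" "l = g j" by (rule orbital_eq)
    then show "M $ i $ j = M $ k $ l" using inv by simp
  qed
qed

lemma mem_adjacency_algebra_symmetrisation:
  assumes part: "partition_on UNIV (symmetrisation (orbitals G))"
  shows "M \<in> adjacency_algebra (symmetrisation (orbitals G)) \<longleftrightarrow>
    M \<in> adjacency_algebra (orbitals G) \<and> transpose M = M"
proof
  assume M: "M \<in> adjacency_algebra (symmetrisation (orbitals G))"
  have const: "M $ i $ j = M $ k $ l"
    if "R \<in> orbitals G" "(i, j) \<in> R \<union> R\<inverse>" "(k, l) \<in> R \<union> R\<inverse>" for R i j k l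
    by (rule adjacency_algebraD[OF part M _ that(2,3)]) (simp add: symmetrisation_def that(1))
  have "M $ j $ i = M $ i $ j" for i j
  proof -
    obtain R where "R \<in> orbitals G" "(i, j) \<in> R" by (rule ex_orbital)
    then show ?thesis using const[of R j i i j] by simp
  qed
  then have "transpose M = M" by (simp add: transpose_def vec_eq_iff)
  moreover have "M \<in> adjacency_algebra (orbitals G)"
    by (rule adjacency_algebraI[OF partition_orbitals]) (rule const, auto)
  ultimately show "M \<in> adjacency_algebra (orbitals G) \<and> transpose M = M" by blast
next
  assume M: "M \<in> adjacency_algebra (orbitals G) \<and> transpose M = M"
  then have sym: "M $ j $ i = M $ i $ j" for i j
    by (metis transpose_def vec_lambda_beta)
  show "M \<in> adjacency_algebra (symmetrisation (orbitals G))"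
  proof (rule adjacency_algebraI[OF part])
    fix S i j k l
    assume "S \<in> symmetrisation (orbitals G)" "(i, j) \<in> S" "(k, l) \<in> S"
    then obtain R where R: "R \<in> orbitals G" "(i, j) \<in> R \<union> R\<inverse>" "(k, l) \<in> R \<union> R\<inverse>"
      by (auto simp: symmetrisation_def)
    note const = adjacency_algebraD[OF partition_orbitals conjunct1[OF M] R(1)]
    \<comment> \<open>Each of the two pairs lies in \<open>R\<close> or in its converse, which gives
      four combinations; symmetry of \<open>M\<close> undoes the swaps.\<close>
    show "M $ i $ j = M $ k $ l"
      using R(2,3) const[of i j k l] const[of j i k l] const[of i j l k] const[of j i l k]
        sym[of i j] sym[of k l]
      by auto
  qed
qed

lemma orbitals_star_algebra: "matrix_star_algebra (adjacency_algebra (orbitals G))"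
proof
  show "mtx.subspace (adjacency_algebra (orbitals G))" by (simp add: adjacency_algebra_def)
next
  fix X Y assume XY: "X \<in> adjacency_algebra (orbitals G)" "Y \<in> adjacency_algebra (orbitals G)"
  have "(X ** Y) $ g i $ g j = (X ** Y) $ i $ j" if g: "g \<in> G" for g i j
  proof -
    have "(X ** Y) $ g i $ g j = (\<Sum>k\<in>UNIV. X $ g i $ g k * Y $ g k $ g j)"
      by (simp add: matrix_matrix_mult_def sum_apply[OF g, of "\<lambda>k. X $ g i $ k * Y $ k $ g j"])
    also have "\<dots> = (X ** Y) $ i $ j"
      using XY g by (simp add: matrix_matrix_mult_def mem_adjacency_algebra_orbitals)
    finally show ?thesis .
  qed
  then show "X ** Y \<in> adjacency_algebra (orbitals G)"
    by (simp add: mem_adjacency_algebra_orbitals)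
next
  fix X assume "X \<in> adjacency_algebra (orbitals G)"
  then show "ctranspose X \<in> adjacency_algebra (orbitals G)"
    by (simp add: mem_adjacency_algebra_orbitals ctranspose_def)
next
  show "mat 1 \<in> adjacency_algebra (orbitals G)"
    using bij by (simp add: mem_adjacency_algebra_orbitals mat_def bij_is_inj inj_eq)
qed

text \<open>All members are symmetric matrices. Stratifiability makes products members again, so a
  product equals its own transpose, which is the product in reverse order.\<close>

lemma symmetrisation_star_algebra:
  assumes "stratifiable (orbitals G)"
  shows "commutative_matrix_star_algebra (adjacency_algebra (symmetrisation (orbitals G)))"
proof -
  let ?A = "adjacency_algebra (symmetrisation (orbitals G))"
  have cc: "coherent_configuration (symmetrisation (orbitals G))"
    using assms by (simp add: stratifiable_def)
  then have "partition_on UNIV (symmetrisation (orbitals G))"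
    by (simp add: coherent_configuration_def)
  note mem = mem_adjacency_algebra_symmetrisation[OF this]
  interpret matrix_star_algebra "adjacency_algebra (orbitals G)" by (rule orbitals_star_algebra)
  show ?thesis
  proof
    show "mtx.subspace ?A" by (simp add: adjacency_algebra_def)
    show "mat 1 \<in> ?A" using one_mem by (simp add: mem)
    show "ctranspose X \<in> ?A" if "X \<in> ?A" for X
      using that ctranspose_closed
      by (simp add: mem) (simp add: ctranspose_def transpose_def vec_eq_iff)
    show mult: "X ** Y \<in> ?A" if "X \<in> ?A" "Y \<in> ?A" for X Y
      using adjacency_algebra_mult_closed[OF cc] that .
    show "X ** Y = Y ** X" if "X \<in> ?A" "Y \<in> ?A" for X Y
    proof -
      have "X ** Y = transpose (X ** Y)" using mult[OF that] by (simp add: mem)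
      also have "\<dots> = Y ** X" using that by (simp add: matrix_transpose_mul mem)
      finally show ?thesis .
    qed
  qed
qed

lemma trivial_idempotent_mem: "trivial_idempotent \<in> adjacency_algebra (orbitals G)"
  by (simp add: mem_adjacency_algebra_orbitals trivial_idempotent_def)

section \<open>From design-orthogonality to witnesses\<close>

lemma inner_permute_vec: "a \<bullet> permute_vec g b = (\<Sum>i\<in>UNIV. a $ i * b $ inv_into UNIV g i)"
  by (simp add: inner_vec_def permute_vec_def)

lemma design_orthogonal_imp_witnesses:
  assumes do: "design_orthogonal (orbitals G) (cvec a) (cvec b)"
  shows "witnesses G a b"
proof -
  interpret matrix_star_algebra "adjacency_algebra (orbitals G)" by (rule orbitals_star_algebra)
  let ?M = "Collect minimal_ideal"
  \<comment> \<open>The contribution of the component of \<open>a\<close> in \<open>B\<close> to the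
    inner product with \<open>permute_vec g b\<close>. Each contribution is shown to be independent
    of \<open>g\<close>.\<close>
  define t where "t B g = (\<Sum>i\<in>UNIV. (cvec a v* ideal_unit B) $ i * of_real (b $ inv_into UNIV g i))" for B g
  have "t B g = t B (\<lambda>x. x)" if B: "minimal_ideal B" and g: "g \<in> G" for B g
  proof -
    define e where "e = ideal_unit B"
    have ideal: "two_sided_ideal (adjacency_algebra (orbitals G)) B"
      using B by (simp add: minimal_ideal_def)
    have herm: "e $ i $ j = cnj (e $ j $ i)" for i j
      using ideal_unit(2)[OF ideal] by (simp add: e_def ctranspose_def vec_eq_iff)
    have "e ** e = e" using ideal ideal_unit_mem ideal_unit_left by (simp add: e_def)
    have eA: "e \<in> adjacency_algebra (orbitals G)"
      using ideal ideal_unit_mem by (auto simp: two_sided_ideal_def e_def)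
    \<comment> \<open>As \<open>e\<close> is a Hermitian idempotent, \<open>herm_form c e\<close> is
      the squared norm of \<open>c v* e\<close>.\<close>
    have vanish: "c v* e = 0" if "herm_form c e = 0" for c
    proof -
      have "herm_form c e = (\<Sum>i\<in>UNIV. ((c v* e) v* e) $ i * cnj (c $ i))"
        by (simp add: herm_form_def vector_matrix_mul_assoc \<open>e ** e = e\<close>)
      also have "\<dots> = (\<Sum>i\<in>UNIV. \<Sum>j\<in>UNIV. (c v* e) $ j * e $ j $ i * cnj (c $ i))"
        by (simp add: vector_matrix_mult_def sum_distrib_right)
      also have "\<dots> = (\<Sum>j\<in>UNIV. \<Sum>i\<in>UNIV. (c v* e) $ j * cnj (c $ i * e $ i $ j))"
        by (subst sum.swap) (simp add: herm[symmetric] mult_ac)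
      also have "\<dots> = (\<Sum>j\<in>UNIV. (c v* e) $ j * cnj ((c v* e) $ j))"
        by (simp add: vector_matrix_mult_def sum_distrib_left)
      also have "\<dots> = of_real (\<Sum>j\<in>UNIV. (cmod ((c v* e) $ j))\<^sup>2)"
        by (simp only: complex_norm_square of_real_sum)
      finally have "(\<Sum>j\<in>UNIV. (cmod ((c v* e) $ j))\<^sup>2) = 0"
        using that by (metis of_real_eq_0_iff)
      then show ?thesis by (simp add: sum_nonneg_eq_0_iff vec_eq_iff)
    qed
    consider "e = trivial_idempotent" | "herm_form (cvec a) e = 0" | "herm_form (cvec b) e = 0"
      using do ideal_unit_central_primitive[OF B] unfolding design_orthogonal_def e_def by fastforce
    then show ?thesis
    proof cases
      case 1
      \<comment> \<open>The component of \<open>a\<close> is a constant vector here, and permuting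
        \<open>b\<close> does not change the sum of its entries.\<close>
      then have "(cvec a v* e) $ i = (\<Sum>j\<in>UNIV. cvec a $ j / of_nat CARD('a))" for i
        by (simp add: vector_matrix_mult_def trivial_idempotent_def)
      then show ?thesis
        using sum_apply[OF inv_closed[OF g], of "\<lambda>i. complex_of_real (b $ i)"]
        by (simp add: t_def e_def[symmetric] inv_unique_comp flip: sum_distrib_left)
    next
      case 2
      then show ?thesis using vanish by (simp add: t_def e_def)
    next
      case 3
      have "t B h = 0" if h: "h \<in> G" for h
      proof -
        have "(\<Sum>i\<in>UNIV. e $ k $ i * of_real (b $ inv_into UNIV h i)) = 0" for k
        proof -
          \<comment> \<open>Invariance of \<open>e\<close> moves the permutation from
            \<open>b\<close> to the index \<open>k\<close>. Since \<open>b\<close> is real and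
            \<open>e\<close> Hermitian, the conjugate of a coordinate of \<open>cvec b v* e\<close>
            remains.\<close>
          have "(\<Sum>i\<in>UNIV. e $ k $ i * of_real (b $ inv_into UNIV h i)) =
              (\<Sum>i\<in>UNIV. e $ inv_into UNIV h k $ inv_into UNIV h i * of_real (b $ inv_into UNIV h i))"
            using eA inv_closed[OF h] by (simp add: mem_adjacency_algebra_orbitals)
          also have "\<dots> = (\<Sum>i\<in>UNIV. e $ inv_into UNIV h k $ i * of_real (b $ i))"
            by (rule sum_apply[OF inv_closed[OF h]])
          also have "\<dots> = cnj ((cvec b v* e) $ inv_into UNIV h k)"
            by (simp add: vector_matrix_mult_def cvec_def herm[symmetric] mult.commute)
          also have "\<dots> = 0" using vanish[OF 3] by simp
          finally show ?thesis .
        qed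
        moreover have "t B h =
            (\<Sum>k\<in>UNIV. cvec a $ k * (\<Sum>i\<in>UNIV. e $ k $ i * of_real (b $ inv_into UNIV h i)))"
          unfolding t_def e_def[symmetric] vector_matrix_mult_def
          by (simp add: sum_distrib_left sum_distrib_right mult.assoc) (rule sum.swap)
        ultimately show ?thesis by simp
      qed
      then show ?thesis using g id_mem by simp
    qed
  qed
  moreover have "of_real (a \<bullet> permute_vec g b) = (\<Sum>B\<in>?M. t B g)" for g
  proof -
    have "cvec a = (\<Sum>B\<in>?M. cvec a v* ideal_unit B)"
    proof -
      have "cvec a v* sum f S = (\<Sum>B\<in>S. cvec a v* f B)"
        for f :: "(complex ^ 'a ^ 'a) set \<Rightarrow> complex ^ 'a ^ 'a" and S
        by (induction S rule: infinite_finite_induct) (simp_all add: vector_matrix_mult_add_rdistrib)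
      from this[of ideal_unit ?M] show ?thesis by (simp add: sum_ideal_unit)
    qed
    then have "cvec a $ i = (\<Sum>B\<in>?M. (cvec a v* ideal_unit B) $ i)" for i
      unfolding sum_component[symmetric] by (rule arg_cong)
    then have "of_real (a $ i) = (\<Sum>B\<in>?M. (cvec a v* ideal_unit B) $ i)" for i
      by (rule trans[rotated]) (simp add: cvec_def)
    then have "of_real (a \<bullet> permute_vec g b) =
        (\<Sum>i\<in>UNIV. \<Sum>B\<in>?M. (cvec a v* ideal_unit B) $ i * of_real (b $ inv_into UNIV g i))"
      by (simp add: inner_permute_vec sum_distrib_right)
    then show ?thesis unfolding t_def by (subst sum.swap)
  qed
  ultimately have "complex_of_real (a \<bullet> permute_vec g b) = of_real (a \<bullet> permute_vec (\<lambda>x. x) b)"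
    if "g \<in> G" for g
    using that by simp
  then show ?thesis unfolding witnesses_def constant_on_def of_real_eq_iff by blast
qed

section \<open>From witnesses to design-orthogonality\<close>

text \<open>The summand for \<open>g\<close> belongs to \<open>a\<close> permuted by the inverse of
  \<open>g\<close>; summing over the whole group makes no difference, and no inverse appears in the
  formula.\<close>

definition orbit_moment :: "real ^ 'a \<Rightarrow> complex ^ 'a ^ 'a" where
  "orbit_moment a = (\<chi> i j. \<Sum>g\<in>G. of_real (a $ g i * a $ g j))"

lemma orbit_moment_mem: "orbit_moment a \<in> adjacency_algebra (orbitals G)"
  unfolding mem_adjacency_algebra_orbitals
proof (intro ballI allI)
  fix h i j assume "h \<in> G"
  then show "orbit_moment a $ h i $ h j = orbit_moment a $ i $ j"
    using sum_comp_right[of h "\<lambda>g. complex_of_real (a $ g i * a $ g j)"]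
    by (simp add: orbit_moment_def)
qed

lemma transpose_orbit_moment: "transpose (orbit_moment a) = orbit_moment a"
  by (simp add: orbit_moment_def transpose_def mult.commute)

text \<open>Expanding an entry of the product gives a double sum over \<open>G\<close> in which the
  inner product of a translate of \<open>a\<close> with a translate of \<open>b\<close> is a
  constant factor. What is left are sums over \<open>G\<close> that do not depend on the row and
  column, by transitivity.\<close>

lemma orbit_moment_mult:
  assumes "witnesses G a b"
  obtains s where "orbit_moment a ** orbit_moment b = mscale s trivial_idempotent"
proof -
  obtain c where c: "\<And>g. g \<in> G \<Longrightarrow> a \<bullet> permute_vec g b = c"
    using assms by (auto simp: witnesses_def constant_on_def)
  have gh: "(\<Sum>k\<in>UNIV. a $ g k * b $ h k) = c" if g: "g \<in> G" and h: "h \<in> G" for g h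
  proof -
    \<comment> \<open>Replacing \<open>k\<close> by its preimage under \<open>g\<close> leaves
      \<open>a\<close> in place and permutes \<open>b\<close> by a single group element.\<close>
    have "(\<Sum>k\<in>UNIV. a $ g k * b $ h k) = (\<Sum>k\<in>UNIV. a $ g (inv_into UNIV g k) * b $ h (inv_into UNIV g k))"
      by (rule sum_apply[OF inv_closed[OF g], symmetric])
    also have "\<dots> = a \<bullet> permute_vec (g \<circ> inv_into UNIV h) b"
      using g h bij inv_closed by (simp add: inner_permute_vec o_inv_distrib inv_inv_eq)
    finally show ?thesis using c g h comp_closed inv_closed by simp
  qed
  have const: "(\<Sum>g\<in>G. v $ g i) = (\<Sum>g\<in>G. v $ g j)" for v :: "real ^ 'a" and i j
  proof -
    obtain h where "h \<in> G" "h j = i" by (rule transitive)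
    then show ?thesis using sum_comp_right[of h "\<lambda>g. v $ g j"] by simp
  qed
  \<comment> \<open>An arbitrary base point at which the constant sums are evaluated.\<close>
  obtain i0 :: 'a where True by simp
  define s where "s = c * (\<Sum>g\<in>G. a $ g i0) * (\<Sum>g\<in>G. b $ g i0)"
  have "(orbit_moment a ** orbit_moment b) $ i $ j = of_real s" for i j
  proof -
    have "(\<Sum>k\<in>UNIV. (\<Sum>g\<in>G. a $ g i * a $ g k) * (\<Sum>h\<in>G. b $ h k * b $ h j)) =
        (\<Sum>k\<in>UNIV. \<Sum>g\<in>G. \<Sum>h\<in>G. a $ g i * b $ h j * (a $ g k * b $ h k))"
      by (simp add: sum_product mult_ac)
    also have "\<dots> = (\<Sum>g\<in>G. \<Sum>k\<in>UNIV. \<Sum>h\<in>G. a $ g i * b $ h j * (a $ g k * b $ h k))"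
      by (rule sum.swap)
    also have "\<dots> = (\<Sum>g\<in>G. \<Sum>h\<in>G. \<Sum>k\<in>UNIV. a $ g i * b $ h j * (a $ g k * b $ h k))"
      by (rule sum.cong[OF refl], rule sum.swap)
    also have "\<dots> = (\<Sum>g\<in>G. \<Sum>h\<in>G. a $ g i * b $ h j * c)"
      by (intro sum.cong refl) (simp add: gh flip: sum_distrib_left)
    also have "\<dots> = c * ((\<Sum>g\<in>G. a $ g i) * (\<Sum>h\<in>G. b $ h j))"
      unfolding sum_product unfolding sum_distrib_left by (simp only: mult_ac)
    also have "\<dots> = s"
      unfolding s_def using const[of a i i0] const[of b j i0] by simp
    finally show ?thesis
      by (simp add: orbit_moment_def matrix_matrix_mult_def flip: of_real_sum of_real_mult)
  qed
  \<comment> \<open>The factor \<open>CARD('a)\<close> compensates for the entries 1/n of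
    \<open>trivial_idempotent\<close>.\<close>
  then have "orbit_moment a ** orbit_moment b =
      mscale (of_nat CARD('a) * of_real s) trivial_idempotent"
    by (simp add: vec_eq_iff mscale_def map_matrix_def trivial_idempotent_def)
  then show ?thesis by (rule that)
qed

text \<open>Because \<open>F\<close> is invariant, every group element contributes the same amount
  \<open>herm_form (cvec a) F\<close> to the trace of \<open>orbit_moment a ** F\<close>;
  \<open>G\<close> contains the identity, so its order can be cancelled.\<close>

lemma herm_form_eq_0:
  assumes F: "F \<in> adjacency_algebra (orbitals G)" and "orbit_moment a ** F = 0"
  shows "herm_form (cvec a) F = 0"
proof -
  have form: "(\<Sum>i\<in>UNIV. \<Sum>j\<in>UNIV. of_real (a $ g i * a $ g j) * F $ j $ i) = herm_form (cvec a) F"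
    if g: "g \<in> G" for g
  proof -
    have "(\<Sum>i\<in>UNIV. \<Sum>j\<in>UNIV. of_real (a $ g i * a $ g j) * F $ j $ i) =
        (\<Sum>i\<in>UNIV. \<Sum>j\<in>UNIV. of_real (a $ g i * a $ g j) * F $ g j $ g i)"
      using F g by (simp add: mem_adjacency_algebra_orbitals)
    also have "\<dots> = (\<Sum>i\<in>UNIV. \<Sum>j\<in>UNIV. of_real (a $ g i * a $ j) * F $ j $ g i)"
      by (intro sum.cong refl sum_apply[OF g])
    also have "\<dots> = (\<Sum>i\<in>UNIV. \<Sum>j\<in>UNIV. of_real (a $ i * a $ j) * F $ j $ i)"
      by (rule sum_apply[OF g])
    also have "\<dots> = herm_form (cvec a) F"
      by (simp add: herm_form_def vector_matrix_mult_def cvec_def sum_distrib_left mult_ac)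
    finally show ?thesis .
  qed
  have "0 = (\<Sum>i\<in>UNIV. (orbit_moment a ** F) $ i $ i)" using assms by simp
  also have "\<dots> = (\<Sum>i\<in>UNIV. \<Sum>j\<in>UNIV. \<Sum>g\<in>G. of_real (a $ g i * a $ g j) * F $ j $ i)"
    by (simp add: matrix_matrix_mult_def orbit_moment_def sum_distrib_right)
  also have "\<dots> = (\<Sum>i\<in>UNIV. \<Sum>g\<in>G. \<Sum>j\<in>UNIV. of_real (a $ g i * a $ g j) * F $ j $ i)"
    by (rule sum.cong[OF refl], rule sum.swap)
  also have "\<dots> = (\<Sum>g\<in>G. \<Sum>i\<in>UNIV. \<Sum>j\<in>UNIV. of_real (a $ g i * a $ g j) * F $ j $ i)"
    by (rule sum.swap)
  also have "\<dots> = (\<Sum>g\<in>G. herm_form (cvec a) F)"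
    by (intro sum.cong refl form)
  finally show ?thesis using id_mem by auto
qed

text \<open>Stated for a commutative subalgebra \<open>A\<close> so that it serves both the
  symmetrisation and the commutative orbital algebra.\<close>

lemma herm_forms_primitive_idempotent:
  assumes "commutative_matrix_star_algebra A" and AG: "A \<subseteq> adjacency_algebra (orbitals G)"
    and E: "trivial_idempotent \<in> A" and Ma: "orbit_moment a \<in> A" and Mb: "orbit_moment b \<in> A"
    and w: "witnesses G a b" and F: "F \<in> primitive_idempotents A" "F \<noteq> trivial_idempotent"
  shows "herm_form (cvec a) F * herm_form (cvec b) F = 0"
proof -
  interpret commutative_matrix_star_algebra A by fact
  have FA: "F \<in> A" and FF: "F ** F = F" using F by (auto simp: primitive_idempotents_def)
  obtain s where s: "orbit_moment a ** orbit_moment b = mscale s trivial_idempotent"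
    using w by (rule orbit_moment_mult)
  \<comment> \<open>The annihilation lemma is applied to \<open>orbit_moment a\<close> and
    \<open>orbit_moment b ** F\<close>; the second \<open>F\<close> that it attaches is absorbed by
    idempotence.\<close>
  have "orbit_moment a ** (orbit_moment b ** F) = mscale s (trivial_idempotent ** F)"
    by (simp add: matrix_mul_assoc s mscale_mult_left)
  also have "\<dots> = 0" by (simp add: primitive_idempotent_mult_trivial[OF F E])
  finally have "orbit_moment a ** (orbit_moment b ** F) = 0" .
  moreover have "orbit_moment b ** F \<in> A" using Mb FA by (rule mult_closed)
  ultimately have "orbit_moment a ** F = 0 \<or> orbit_moment b ** F ** F = 0"
    using primitive_idempotent_annihilates[OF F(1) Ma] by blast
  moreover have "orbit_moment b ** F ** F = orbit_moment b ** F"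
    by (simp add: FF flip: matrix_mul_assoc)
  ultimately show ?thesis using herm_form_eq_0 FA AG by auto
qed

text \<open>The moment matrices and \<open>trivial_idempotent\<close> are symmetric, which places
  them in the algebra of the symmetrisation.\<close>

lemma witnesses_imp_scheme_design_orthogonal:
  assumes "witnesses G a b" and strat: "stratifiable (orbitals G)"
  shows "scheme_design_orthogonal (symmetrisation (orbitals G)) (cvec a) (cvec b)"
proof -
  have "partition_on UNIV (symmetrisation (orbitals G))"
    using strat by (simp add: stratifiable_def coherent_configuration_def)
  note mem = mem_adjacency_algebra_symmetrisation[OF this]
  have "transpose trivial_idempotent = (trivial_idempotent :: complex ^ 'a ^ 'a)"
    by (simp add: transpose_def trivial_idempotent_def)
  then show ?thesis
    unfolding scheme_design_orthogonal_def
    by (intro ballI herm_forms_primitive_idempotent[OF symmetrisation_star_algebra[OF strat]] assms(1))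
      (auto simp: mem trivial_idempotent_mem orbit_moment_mem transpose_orbit_moment)
qed

text \<open>In a commutative algebra the central primitive idempotents are primitive, so the
  statement on primitive idempotents covers them.\<close>

lemma witnesses_imp_design_orthogonal:
  assumes "witnesses G a b" and "commutative_cc (orbitals G)"
  shows "design_orthogonal (orbitals G) (cvec a) (cvec b)"
proof -
  have comm: "commutative_matrix_star_algebra (adjacency_algebra (orbitals G))"
    using orbitals_star_algebra assms(2)
    by (simp add: commutative_matrix_star_algebra_def commutative_matrix_star_algebra_axioms_def
        commutative_cc_def)
  show ?thesis
    unfolding design_orthogonal_def
    using herm_forms_primitive_idempotent[OF comm] assms(1) trivial_idempotent_mem orbit_moment_mem
      commutative_matrix_star_algebra.central_primitive_imp_primitive[OF comm]
    by blast
qed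

end

theorem theorem5p13:
  fixes G :: "('a :: finite \<Rightarrow> 'a) set"
    and u v w x :: "real ^ 'a"
    and m :: nat
    and y :: "nat \<Rightarrow> real ^ 'a"
  assumes "transitive_permutation_group G"
    and "zero_one_vec u" "nontrivial_vec u"
    and "zero_one_vec v" "nontrivial_vec v"
    and "nonneg_int_vec w" "nontrivial_vec w"
    and "nonneg_int_vec x" "nontrivial_vec x"
    and "\<forall>i\<in>{1..m}. zero_one_vec (y i) \<and> nontrivial_vec (y i)"
  shows
    "\<comment> \<open>non-QI\<close>
     ((design_orthogonal (orbitals G) (cvec w) (cvec x) \<longrightarrow> witnesses G w x) \<and>
      (witnesses G w x \<longrightarrow>
         (stratifiable (orbitals G) \<longrightarrow>
            scheme_design_orthogonal (symmetrisation (orbitals G)) (cvec w) (cvec x)) \<and>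
         (commutative_cc (orbitals G) \<longrightarrow>
            design_orthogonal (orbitals G) (cvec w) (cvec x))))
     \<and>
     \<comment> \<open>nonspreading\<close>
     ((\<exists>k. w \<bullet> 1 = real k \<and> k dvd CARD('a)) \<longrightarrow>
      (design_orthogonal (orbitals G) (cvec u) (cvec w) \<longrightarrow> witnesses G u w) \<and>
      (witnesses G u w \<longrightarrow>
         (stratifiable (orbitals G) \<longrightarrow>
            scheme_design_orthogonal (symmetrisation (orbitals G)) (cvec u) (cvec w)) \<and>
         (commutative_cc (orbitals G) \<longrightarrow>
            design_orthogonal (orbitals G) (cvec u) (cvec w))))
     \<and>
     \<comment> \<open>nonseparating\<close>
     ((u \<bullet> 1) * (v \<bullet> 1) = real CARD('a) \<longrightarrow>
      (design_orthogonal (orbitals G) (cvec u) (cvec v) \<longrightarrow> witnesses G u v) \<and>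
      (witnesses G u v \<longrightarrow>
         (stratifiable (orbitals G) \<longrightarrow>
            scheme_design_orthogonal (symmetrisation (orbitals G)) (cvec u) (cvec v)) \<and>
         (commutative_cc (orbitals G) \<longrightarrow>
            design_orthogonal (orbitals G) (cvec u) (cvec v))))
     \<and>
     \<comment> \<open>nonsynchronising\<close>
     ((\<forall>i\<in>{1..m}. (y i \<bullet> 1) * (v \<bullet> 1) = real CARD('a)) \<and> (\<Sum>i=1..m. y i) = 1 \<longrightarrow>
      ((\<forall>i\<in>{1..m}. design_orthogonal (orbitals G) (cvec (y i)) (cvec v)) \<longrightarrow>
         (\<forall>i\<in>{1..m}. witnesses G (y i) v)) \<and>
      ((\<forall>i\<in>{1..m}. witnesses G (y i) v) \<longrightarrow>
         (stratifiable (orbitals G) \<longrightarrow>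
            (\<forall>i\<in>{1..m}. scheme_design_orthogonal (symmetrisation (orbitals G)) (cvec (y i)) (cvec v))) \<and>
         (commutative_cc (orbitals G) \<longrightarrow>
            (\<forall>i\<in>{1..m}. design_orthogonal (orbitals G) (cvec (y i)) (cvec v)))))"
proof -
  interpret transitive_group G using assms(1) by unfold_locales
  \<comment> \<open>Each of the four cases is an instance of this statement about a pair of real
    vectors; the last one takes the pairs \<open>y i\<close>, \<open>v\<close> for all
    \<open>i\<close>.\<close>
  have *: "(design_orthogonal (orbitals G) (cvec a) (cvec b) \<longrightarrow> witnesses G a b) \<and>
      (witnesses G a b \<longrightarrow>
        (stratifiable (orbitals G) \<longrightarrow>
          scheme_design_orthogonal (symmetrisation (orbitals G)) (cvec a) (cvec b)) \<and>
        (commutative_cc (orbitals G) \<longrightarrow> design_orthogonal (orbitals G) (cvec a) (cvec b)))"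
    for a b
    using design_orthogonal_imp_witnesses witnesses_imp_scheme_design_orthogonal
      witnesses_imp_design_orthogonal by blast
  show ?thesis
    using *[of w x] *[of u w] *[of u v] *[of "y i" v for i] by blast
qed

end
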